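(* Let $F$ be a field with $\operatorname{char} F = 0$. Every finite nonempty sequence over the alphabet $\{{\tt A},{\tt S},{\tt N}\}$ that does not contain ${\tt N}$ and ends in ${\tt A}$ is the qpr-sequence of some symmetric matrix over $F$.
   Context: For an $n\times n$ matrix $B$ and $\alpha,\beta\subseteq\{1,\dots,n\}$, $B[\alpha,\beta]$ denotes the submatrix with rows indexed by $\alpha$ and columns indexed by $\beta$. $B[\alpha,\beta]$ is a quasi-principal submatrix if $|\alpha|=|\beta|$ and $|\alpha|-1\le|\alpha\cap\beta|\le|\alpha|$; its determinant is then a quasi-principal minor of order $|\alpha|$. The quasi principal rank characteristic sequence (qpr-sequence) of a symmetric $B\in F^{n\times n}$ is $\operatorname{qpr}(B)=q_1q_2\cdots q_n$, where $q_k={\tt A}$ if all quasi-principal minors of order $k$ are nonzero, $q_k={\tt S}$ if some but not all are nonzero, and $q_k={\tt N}$ if all are zero. A sequence of length $n$ is attainable if it equals $\operatorname{qpr}(B)$ for some symmetric $B\in F^{n\times n}$. *)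

theory Defs
  imports
    "Jordan_Normal_Form.Determinant"
    "Jordan_Normal_Form.DL_Submatrix"
begin

datatype qpr_letter = qA | qS | qN

text \<open>Row and column indices start at 0, so the index set of an \<open>n \<times> n\<close> matrix is \<open>{..<n}\<close>.\<close>

definition quasi_principal :: "nat \<Rightarrow> nat set \<Rightarrow> nat set \<Rightarrow> bool" where
  "quasi_principal n \<alpha> \<beta> \<longleftrightarrow>
     \<alpha> \<subseteq> {..<n} \<and> \<beta> \<subseteq> {..<n} \<and> card \<alpha> = card \<beta> \<and>
     card \<alpha> - 1 \<le> card (\<alpha> \<inter> \<beta>) \<and> card (\<alpha> \<inter> \<beta>) \<le> card \<alpha>"

definition qp_minors :: "'a :: comm_ring_1 mat \<Rightarrow> nat \<Rightarrow> 'a set" where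
  "qp_minors B k =
     {det (submatrix B \<alpha> \<beta>) | \<alpha> \<beta>. quasi_principal (dim_row B) \<alpha> \<beta> \<and> card \<alpha> = k}"

definition qpr_entry :: "'a :: comm_ring_1 mat \<Rightarrow> nat \<Rightarrow> qpr_letter" where
  "qpr_entry B k =
     (if \<forall>m \<in> qp_minors B k. m \<noteq> 0 then qA
      else if \<forall>m \<in> qp_minors B k. m = 0 then qN
      else qS)"

text \<open>The list position \<open>k - 1\<close> holds the letter for order \<open>k\<close>.\<close>

definition qpr :: "'a :: comm_ring_1 mat \<Rightarrow> qpr_letter list" where
  "qpr B = map (qpr_entry B) [1..<dim_row B + 1]"

end

theory Submission
  imports Defs
begin

text \<open>
  The sequence is built one letter at a time. Let \<open>B\<close> be a nonsingular symmetric matrix of order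
  \<open>n\<close>, and border it by the column \<open>B z\<close> and a corner entry \<open>t\<close>, with \<open>z\<close> supported on a set \<open>L\<close>
  of indices. If all quasi-principal minors of \<open>B\<close> of order \<open>k \<le> card L\<close> are nonzero, then no
  quasi-principal minor of order \<open>k\<close> of the bordered matrix vanishes identically in \<open>(z, t)\<close>: for
  \<open>z = e\<^sub>l\<close> or \<open>z = e\<^sub>i + e\<^sub>j\<close> and \<open>t = z\<^sup>T B z\<close> the bordered matrix is \<open>P\<^sup>T B P\<close> with
  \<open>P = (I z)\<close>, and the minor reduces to one of \<open>B\<close>. As the field is infinite, a generic \<open>(z, t)\<close>
  makes all these minors, and the determinant, nonzero at once. Taking for \<open>L\<close> all indices produces
  the letter \<open>A\<close> at order \<open>n\<close>; omitting one index \<open>m\<close> makes the new column depend on the columns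
  other than \<open>m\<close>, which produces a vanishing minor of order \<open>n\<close> and hence the letter \<open>S\<close>.
\<close>

section \<open>Minors and kernels\<close>

text \<open>Entries are given by a function on all pairs of indices, so bordering extends that
  function while the old index sets keep their meaning.\<close>

definition minor :: "(nat \<Rightarrow> nat \<Rightarrow> 'a :: comm_ring_1) \<Rightarrow> nat set \<Rightarrow> nat set \<Rightarrow> 'a" where
  "minor f \<alpha> \<beta> = det (mat (card \<alpha>) (card \<beta>) (\<lambda>(i, j). f (pick \<alpha> i) (pick \<beta> j)))"

text \<open>Injectivity of the submatrix with rows \<alpha> and columns \<beta>. Vectors are indexed
  by \<beta> itself, so that \<open>pick\<close> disappears from the linear algebra.\<close>

definition trivial_kernel :: "(nat \<Rightarrow> nat \<Rightarrow> 'a :: comm_ring_1) \<Rightarrow> nat set \<Rightarrow> nat set \<Rightarrow> bool" where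
  "trivial_kernel f \<alpha> \<beta> \<longleftrightarrow>
     (\<forall>v. (\<forall>a\<in>\<alpha>. (\<Sum>b\<in>\<beta>. f a b * v b) = 0) \<longrightarrow> (\<forall>b\<in>\<beta>. v b = 0))"

lemma bij_betw_pick:
  assumes "finite S"
  shows "bij_betw (pick S) {0..<card S} S"
proof (rule bij_betw_imageI)
  show inj: "inj_on (pick S) {0..<card S}"
  proof (rule inj_onI)
    fix x y assume "x \<in> {0..<card S}" "y \<in> {0..<card S}" "pick S x = pick S y"
    then show "x = y" using pick_mono_le[of y S x] pick_mono_le[of x S y]
      by (cases x y rule: linorder_cases) auto
  qed
  have "pick S ` {0..<card S} \<subseteq> S" by (auto intro: pick_in_set_le)
  moreover have "card (pick S ` {0..<card S}) = card S" using card_image[OF inj] by simp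
  ultimately show "pick S ` {0..<card S} = S" using assms card_subset_eq by blast
qed

lemma submatrix_mat_eq:
  assumes "\<alpha> \<subseteq> {..<n}" "\<beta> \<subseteq> {..<n}"
  shows "submatrix (mat n n (\<lambda>(i, j). f i j)) \<alpha> \<beta>
    = mat (card \<alpha>) (card \<beta>) (\<lambda>(i, j). f (pick \<alpha> i) (pick \<beta> j))"
proof -
  have "{i. i < n \<and> i \<in> \<alpha>} = \<alpha>" "{i. i < n \<and> i \<in> \<beta>} = \<beta>" using assms by auto
  moreover have "pick \<alpha> i < n" if "i < card \<alpha>" for i using pick_in_set_le[OF that] assms by auto
  moreover have "pick \<beta> i < n" if "i < card \<beta>" for i using pick_in_set_le[OF that] assms by auto
  ultimately show ?thesis unfolding submatrix_def by (intro eq_matI) auto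
qed

lemma minor_cong:
  assumes "\<And>a b. a \<in> \<alpha> \<Longrightarrow> b \<in> \<beta> \<Longrightarrow> f a b = g a b"
  shows "minor f \<alpha> \<beta> = minor g \<alpha> \<beta>"
  unfolding minor_def
  by (rule arg_cong[where f = det], rule eq_matI) (auto intro: assms pick_in_set_le)

lemma minor_sym:
  assumes "\<And>a b. f a b = f b a" "card \<alpha> = card \<beta>"
  shows "minor f \<alpha> \<beta> = minor f \<beta> \<alpha>"
proof -
  let ?M = "mat (card \<alpha>) (card \<beta>) (\<lambda>(i, j). f (pick \<alpha> i) (pick \<beta> j))"
  have "transpose_mat ?M = mat (card \<beta>) (card \<alpha>) (\<lambda>(i, j). f (pick \<beta> i) (pick \<alpha> j))"
    using assms(1) by (intro eq_matI) auto
  moreover have "det (transpose_mat ?M) = det ?M"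
    using assms(2) by (intro det_transpose[of _ "card \<alpha>"]) auto
  ultimately show ?thesis unfolding minor_def by simp
qed

text \<open>A square matrix over a field is singular exactly if it kills a nonzero vector;
  \<open>pick\<close> translates between positions and indices. Nonvanishing of a minor becomes a
  question about a linear system.\<close>

lemma minor_nonzero_iff:
  fixes f :: "nat \<Rightarrow> nat \<Rightarrow> 'a :: field"
  assumes fin: "finite \<alpha>" "finite \<beta>" and card: "card \<alpha> = card \<beta>"
  shows "minor f \<alpha> \<beta> \<noteq> 0 \<longleftrightarrow> trivial_kernel f \<alpha> \<beta>"
proof -
  define k where "k = card \<beta>"
  define M where "M = mat k k (\<lambda>(i, j). f (pick \<alpha> i) (pick \<beta> j))"
  have M: "M \<in> carrier_mat k k" by (simp add: M_def)
  have pa: "bij_betw (pick \<alpha>) {0..<k} \<alpha>" and pb: "bij_betw (pick \<beta>) {0..<k} \<beta>"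
    using bij_betw_pick[OF fin(1)] bij_betw_pick[OF fin(2)] card by (simp_all add: k_def)
  have sum: "(\<Sum>b\<in>\<beta>. f a b * v b) = (\<Sum>j=0..<k. f a (pick \<beta> j) * v (pick \<beta> j))" for a v
    using sum.reindex_bij_betw[OF pb, of "\<lambda>b. f a b * v b"] by simp
  have mult: "(M *\<^sub>v vec k w) $ i = (\<Sum>j=0..<k. f (pick \<alpha> i) (pick \<beta> j) * w j)" if "i < k" for w i
    using that by (simp add: M_def scalar_prod_def)
  have "minor f \<alpha> \<beta> \<noteq> 0 \<longleftrightarrow> det M \<noteq> 0" unfolding minor_def M_def k_def card ..
  also have "\<dots> \<longleftrightarrow> (\<forall>w. M *\<^sub>v vec k w = 0\<^sub>v k \<longrightarrow> vec k w = 0\<^sub>v k)"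
  proof -
    have "(\<exists>v. v \<in> carrier_vec k \<and> Q v) \<longleftrightarrow> (\<exists>w. Q (vec k w))" for Q :: "'a vec \<Rightarrow> bool"
    proof
      assume "\<exists>v. v \<in> carrier_vec k \<and> Q v"
      then obtain v where v: "v \<in> carrier_vec k" "Q v" by blast
      then have "vec k (\<lambda>i. v $ i) = v" by auto
      with v show "\<exists>w. Q (vec k w)" by metis
    qed (metis vec_carrier)
    from this[of "\<lambda>v. v \<noteq> 0\<^sub>v k \<and> M *\<^sub>v v = 0\<^sub>v k"] show ?thesis
      unfolding det_0_iff_vec_prod_zero_field[OF M] by auto
  qed
  also have "\<dots> \<longleftrightarrow> (\<forall>w. (\<forall>i<k. (\<Sum>j=0..<k. f (pick \<alpha> i) (pick \<beta> j) * w j) = 0) \<longrightarrow> (\<forall>j<k. w j = 0))"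
  proof -
    have "M *\<^sub>v vec k w = 0\<^sub>v k \<longleftrightarrow> (\<forall>i<k. (\<Sum>j=0..<k. f (pick \<alpha> i) (pick \<beta> j) * w j) = 0)" for w
      using M by (auto simp: vec_eq_iff mult[symmetric] simp del: index_mult_mat_vec)
    then show ?thesis by (auto simp: vec_eq_iff)
  qed
  also have "\<dots> \<longleftrightarrow> trivial_kernel f \<alpha> \<beta>"
  proof
    assume H: "\<forall>w. (\<forall>i<k. (\<Sum>j=0..<k. f (pick \<alpha> i) (pick \<beta> j) * w j) = 0) \<longrightarrow> (\<forall>j<k. w j = 0)"
    show "trivial_kernel f \<alpha> \<beta>" unfolding trivial_kernel_def
    proof (intro allI impI ballI)
      fix v b assume v: "\<forall>a\<in>\<alpha>. (\<Sum>b\<in>\<beta>. f a b * v b) = 0" and b: "b \<in> \<beta>"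
      have "b \<in> pick \<beta> ` {0..<k}" using b bij_betw_imp_surj_on[OF pb] by simp
      then obtain j where "j < k" "b = pick \<beta> j" by auto
      moreover have "pick \<alpha> i \<in> \<alpha>" if "i < k" for i using that bij_betwE[OF pa] by simp
      ultimately show "v b = 0" using H[rule_format, of "\<lambda>j. v (pick \<beta> j)" j] v sum by simp
    qed
  next
    assume H: "trivial_kernel f \<alpha> \<beta>"
    show "\<forall>w. (\<forall>i<k. (\<Sum>j=0..<k. f (pick \<alpha> i) (pick \<beta> j) * w j) = 0) \<longrightarrow> (\<forall>j<k. w j = 0)"
    proof (intro allI impI)
      fix w j assume w: "\<forall>i<k. (\<Sum>j=0..<k. f (pick \<alpha> i) (pick \<beta> j) * w j) = 0" and j: "j < k"
      \<comment> \<open>The vector \<open>w\<close> on positions is carried over to \<beta> by the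
        inverse of the enumeration.\<close>
      define v where "v = w \<circ> the_inv_into {0..<k} (pick \<beta>)"
      have v: "v (pick \<beta> j) = w j" if "j < k" for j
        using that the_inv_into_f_f[OF bij_betw_imp_inj_on[OF pb]] by (simp add: v_def)
      have "(\<Sum>b\<in>\<beta>. f a b * v b) = 0" if "a \<in> \<alpha>" for a
      proof -
        have "a \<in> pick \<alpha> ` {0..<k}" using that bij_betw_imp_surj_on[OF pa] by simp
        then obtain i where "i < k" "a = pick \<alpha> i" by auto
        then show ?thesis using w v by (simp add: sum)
      qed
      then have "v (pick \<beta> j) = 0"
        using H j bij_betwE[OF pb] unfolding trivial_kernel_def by simp
      then show "w j = 0" using v[OF j] by simp
    qed
  qed
  finally show ?thesis .
qed

section \<open>Functions that are polynomial along lines\<close>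

text \<open>Restriction to every affine line is a univariate polynomial. This property is closed
  under sums and products and suffices for a generic choice, so multivariate polynomials are
  avoided.\<close>

definition line_polynomial :: "((nat \<Rightarrow> 'a :: comm_ring_1) \<Rightarrow> 'a) \<Rightarrow> bool" where
  "line_polynomial F \<longleftrightarrow> (\<forall>p q. \<exists>P. \<forall>x. F (\<lambda>i. p i + x * q i) = poly P x)"

lemma line_polynomialI:
  assumes "\<And>p q x. F (\<lambda>i. p i + x * q i) = poly (P p q) x"
  shows "line_polynomial F"
  using assms unfolding line_polynomial_def by blast

lemma line_polynomialE:
  assumes "line_polynomial F"
  obtains P where "\<And>p q x. F (\<lambda>i. p i + x * q i) = poly (P p q) x"
  using assms unfolding line_polynomial_def by metis

lemma line_polynomial_const: "line_polynomial (\<lambda>p. c)"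
  by (rule line_polynomialI[of _ "\<lambda>_ _. [:c:]"]) simp

lemma line_polynomial_coordinate: "line_polynomial (\<lambda>p. p i)"
  by (rule line_polynomialI[of _ "\<lambda>p q. [:p i, q i:]"]) simp

lemma line_polynomial_mult:
  assumes "line_polynomial F" "line_polynomial G"
  shows "line_polynomial (\<lambda>p. F p * G p)"
proof -
  obtain P Q where "\<And>p q x. F (\<lambda>i. p i + x * q i) = poly (P p q) x"
    "\<And>p q x. G (\<lambda>i. p i + x * q i) = poly (Q p q) x"
    using assms by (metis line_polynomialE)
  then show ?thesis by (intro line_polynomialI[of _ "\<lambda>p q. P p q * Q p q"]) simp
qed

lemma line_polynomial_add:
  assumes "line_polynomial F" "line_polynomial G"
  shows "line_polynomial (\<lambda>p. F p + G p)"
proof -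
  obtain P Q where "\<And>p q x. F (\<lambda>i. p i + x * q i) = poly (P p q) x"
    "\<And>p q x. G (\<lambda>i. p i + x * q i) = poly (Q p q) x"
    using assms by (metis line_polynomialE)
  then show ?thesis by (intro line_polynomialI[of _ "\<lambda>p q. P p q + Q p q"]) simp
qed

lemma line_polynomial_sum:
  assumes "\<And>i. i \<in> I \<Longrightarrow> line_polynomial (F i)"
  shows "line_polynomial (\<lambda>p. \<Sum>i\<in>I. F i p)"
  using assms
  by (induction I rule: infinite_finite_induct)
    (auto intro: line_polynomial_const line_polynomial_add)

lemma line_polynomial_prod:
  assumes "\<And>i. i \<in> I \<Longrightarrow> line_polynomial (F i)"
  shows "line_polynomial (\<lambda>p. \<Prod>i\<in>I. F i p)"
  using assms
  by (induction I rule: infinite_finite_induct)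
    (auto intro: line_polynomial_const line_polynomial_mult)

text \<open>The Leibniz formula makes the minor a sum of products of entries.\<close>

lemma line_polynomial_minor:
  assumes "\<And>a b. line_polynomial (\<lambda>p. f p a b)" "card \<alpha> = card \<beta>"
  shows "line_polynomial (\<lambda>p. minor (f p) \<alpha> \<beta>)"
proof -
  have "minor (f p) \<alpha> \<beta> = (\<Sum>\<pi> | \<pi> permutes {0..<card \<beta>}.
      signof \<pi> * (\<Prod>i = 0..<card \<beta>. f p (pick \<alpha> i) (pick \<beta> (\<pi> i))))" for p
    unfolding minor_def assms(2)
    by (subst det_def'[of _ "card \<beta>"]) (auto intro!: sum.cong prod.cong simp: permutes_in_image)
  then show ?thesis
    by (simp add: line_polynomial_sum line_polynomial_mult line_polynomial_const
      line_polynomial_prod assms(1))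
qed

text \<open>A point good for the earlier functions and a point good for the new one are joined by a
  line. On it each function is a nonzero polynomial with finitely many roots, and the infinite field
  leaves a common non-root.\<close>

lemma ex_common_nonzero:
  fixes F :: "'i \<Rightarrow> (nat \<Rightarrow> 'a :: field_char_0) \<Rightarrow> 'a"
  assumes "finite I" "\<And>i. i \<in> I \<Longrightarrow> line_polynomial (F i)" "\<And>i. i \<in> I \<Longrightarrow> \<exists>p. F i p \<noteq> 0"
  shows "\<exists>p. \<forall>i\<in>I. F i p \<noteq> 0"
  using assms
proof (induction I rule: finite_induct)
  case (insert j I)
  obtain p where p: "\<forall>i\<in>I. F i p \<noteq> 0" using insert by auto
  obtain q where q: "F j q \<noteq> 0" using insert.prems by auto
  define \<gamma> where "\<gamma> x = (\<lambda>i. p i + x * (q i - p i))" for x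
  have \<gamma>: "\<gamma> 0 = p" "\<gamma> 1 = q" by (auto simp: \<gamma>_def)
  have fin: "finite {x. F i (\<gamma> x) = 0}" if i: "i \<in> insert j I" for i
  proof -
    obtain P where P: "\<And>x. F i (\<gamma> x) = poly P x"
      using line_polynomialE[OF insert.prems(1)[OF i]] unfolding \<gamma>_def by metis
    \<comment> \<open>Parameter 0 gives \<open>p\<close>, which serves \<open>I\<close>; parameter 1
      gives \<open>q\<close>, which serves \<open>j\<close>.\<close>
    have "F i (\<gamma> 0) \<noteq> 0 \<or> F i (\<gamma> 1) \<noteq> 0" using p q i \<gamma> by auto
    then have "P \<noteq> 0" using P by auto
    then show ?thesis using P poly_roots_finite by simp
  qed
  have "finite (\<Union>i\<in>insert j I. {x. F i (\<gamma> x) = 0})" using fin insert.hyps by blast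
  then obtain x where "x \<notin> (\<Union>i\<in>insert j I. {x. F i (\<gamma> x) = 0})"
    using ex_new_if_finite[OF infinite_UNIV_char_0] by metis
  then show ?case by blast
qed simp

section \<open>Bordered matrices\<close>

text \<open>The sums run over \<open>L\<close> instead of requiring \<open>z\<close> to vanish
  elsewhere, so \<open>z\<close> may range over all functions, as the argument along lines
  demands.\<close>

definition border :: "(nat \<Rightarrow> nat \<Rightarrow> 'a :: comm_ring_1) \<Rightarrow> nat \<Rightarrow> nat set \<Rightarrow> (nat \<Rightarrow> 'a) \<Rightarrow> 'a \<Rightarrow> nat \<Rightarrow> nat \<Rightarrow> 'a"
  where "border f n L z t i j =
    (if i < n then if j < n then f i j else \<Sum>l\<in>L. f i l * z l
     else if j < n then \<Sum>l\<in>L. f j l * z l else t)"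

lemma border_sym: "(\<And>i j. f i j = f j i) \<Longrightarrow> border f n L z t i j = border f n L z t j i"
  by (simp add: border_def)

text \<open>One point \<open>p\<close> supplies both the coefficients of the new column and, at
  coordinate \<open>n\<close>, the corner.\<close>

lemma line_polynomial_border: "line_polynomial (\<lambda>p. border f n L p (p n) i j)"
proof -
  have "line_polynomial (\<lambda>p. \<Sum>l\<in>L. f i l * p l)" for i
    by (intro line_polynomial_sum line_polynomial_mult line_polynomial_const line_polynomial_coordinate)
  then show ?thesis
    by (cases "i < n"; cases "j < n")
      (simp_all add: border_def line_polynomial_const line_polynomial_coordinate)
qed

text \<open>The new column combines columns of \<open>f\<close> with coefficients \<open>z\<close>,
  so its weight \<open>v n\<close> can be spread over them. On the right stands row \<open>a\<close>
  of \<open>f\<close> applied to \<open>P v\<close> with \<open>P = (I z)\<close>; \<open>S\<close>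
  holds the support of \<open>P v\<close>.\<close>

lemma border_row_old:
  assumes "finite S" "\<beta> \<subseteq> S" "S \<subseteq> {..<n}" "L \<subseteq> {..<n}" "\<And>l. z l \<noteq> 0 \<Longrightarrow> l \<in> S \<inter> L" "a < n"
  shows "(\<Sum>b\<in>insert n \<beta>. border f n L z t a b * v b) =
    (\<Sum>b\<in>S. f a b * ((if b \<in> \<beta> then v b else 0) + v n * z b))"
proof -
  have fin: "finite \<beta>" "finite L" "n \<notin> \<beta>" using assms finite_subset[of L] finite_subset[of \<beta>] by auto
  have "(\<Sum>b\<in>insert n \<beta>. border f n L z t a b * v b) = (\<Sum>l\<in>L. f a l * z l) * v n + (\<Sum>b\<in>\<beta>. f a b * v b)"
    using fin assms by (subst sum.insert) (auto simp: border_def intro!: sum.cong)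
  also have "(\<Sum>l\<in>L. f a l * z l) = (\<Sum>l\<in>S. f a l * z l)"
    by (rule sum.mono_neutral_cong) (use fin assms in force)+
  also have "(\<Sum>b\<in>\<beta>. f a b * v b) = (\<Sum>b\<in>S. f a b * (if b \<in> \<beta> then v b else 0))"
    by (rule sum.mono_neutral_cong_left) (use assms in auto)
  finally show ?thesis by (simp add: sum_distrib_left sum.distrib algebra_simps)
qed

text \<open>With corner \<open>z^T f z\<close> the whole new row, corner included, is the
  combination of the old rows with coefficients \<open>z\<close>.\<close>

lemma border_row_new:
  assumes "\<And>i j. f i j = f j i"
    and "finite S" "\<beta> \<subseteq> S" "S \<subseteq> {..<n}" "L \<subseteq> {..<n}" "\<And>l. z l \<noteq> 0 \<Longrightarrow> l \<in> S \<inter> L"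
  shows "(\<Sum>b\<in>insert n \<beta>. border f n L z (\<Sum>a\<in>L. z a * (\<Sum>l\<in>L. f a l * z l)) n b * v b) =
    (\<Sum>a\<in>L. z a * (\<Sum>b\<in>S. f a b * ((if b \<in> \<beta> then v b else 0) + v n * z b)))"
    (is "?l = _")
proof -
  have fin: "finite \<beta>" "finite L" "n \<notin> \<beta>" using assms finite_subset[of L] finite_subset[of \<beta>] by auto
  have "?l = (\<Sum>a\<in>L. z a * (\<Sum>l\<in>L. f a l * z l)) * v n + (\<Sum>b\<in>\<beta>. (\<Sum>a\<in>L. f b a * z a) * v b)"
    using fin assms by (subst sum.insert) (auto simp: border_def intro!: sum.cong)
  also have "(\<Sum>b\<in>\<beta>. (\<Sum>a\<in>L. f b a * z a) * v b) = (\<Sum>a\<in>L. z a * (\<Sum>b\<in>\<beta>. f a b * v b))"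
    unfolding sum_distrib_left sum_distrib_right
    by (subst sum.swap) (auto intro!: sum.cong simp: assms(1) mult_ac)
  \<comment> \<open>The rows in \<open>L\<close> are old rows and never meet the corner, so the
    value 0 there is arbitrary.\<close>
  also have "(\<Sum>a\<in>L. z a * (\<Sum>l\<in>L. f a l * z l)) * v n + \<dots>
     = (\<Sum>a\<in>L. z a * (\<Sum>b\<in>insert n \<beta>. border f n L z 0 a b * v b))"
    using fin assms unfolding sum_distrib_right sum.distrib[symmetric]
    by (intro sum.cong refl, subst sum.insert)
      (auto simp: border_def algebra_simps subset_iff intro!: sum.cong)
  also have "\<dots> = (\<Sum>a\<in>L. z a * (\<Sum>b\<in>S. f a b * ((if b \<in> \<beta> then v b else 0) + v n * z b)))"
    by (intro sum.cong refl, subst border_row_old[of S]) (use assms in auto)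
  finally show ?thesis .
qed

section \<open>Quasi-principal pairs of index sets\<close>

lemma quasi_principal_same: "\<alpha> \<subseteq> {..<n} \<Longrightarrow> quasi_principal n \<alpha> \<alpha>"
  by (simp add: quasi_principal_def)

text \<open>The indices \<open>i\<close> and \<open>j\<close> may coincide, which gives a principal
  pair; the column case below relies on this.\<close>

lemma quasi_principal_insert:
  assumes "insert i \<gamma> \<subseteq> {..<n}" "insert j \<gamma> \<subseteq> {..<n}" "i \<notin> \<gamma>" "j \<notin> \<gamma>"
  shows "quasi_principal n (insert i \<gamma>) (insert j \<gamma>)"
proof -
  have fin: "finite \<gamma>" using assms(1) finite_subset by auto
  then have "card \<gamma> \<le> card (insert i \<gamma> \<inter> insert j \<gamma>)" by (intro card_mono) auto
  moreover have "card (insert i \<gamma> \<inter> insert j \<gamma>) \<le> card (insert i \<gamma>)"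
    using fin by (intro card_mono) auto
  ultimately show ?thesis using fin assms by (simp add: quasi_principal_def)
qed

text \<open>For distinct sets of equal size the intersection is proper, so the lower bound on its
  size leaves exactly one element of each set outside it.\<close>

lemma quasi_principal_cases:
  assumes "quasi_principal n \<alpha> \<beta>"
  obtains "\<alpha> = \<beta>"
  | i j \<gamma> where "\<alpha> = insert i \<gamma>" "\<beta> = insert j \<gamma>" "i \<notin> \<gamma>" "j \<notin> \<gamma>" "i \<noteq> j"
proof (cases "\<alpha> = \<beta>")
  case False
  define \<gamma> where "\<gamma> = \<alpha> \<inter> \<beta>"
  have sub: "\<alpha> \<subseteq> {..<n}" "\<beta> \<subseteq> {..<n}" and eq: "card \<alpha> = card \<beta>" and le: "card \<alpha> - 1 \<le> card \<gamma>"
    using assms by (auto simp: quasi_principal_def \<gamma>_def)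
  have fin: "finite \<alpha>" "finite \<beta>" using sub finite_subset by auto
  have "\<gamma> \<subset> \<alpha>" using False fin eq card_subset_eq[of \<beta> \<alpha>] by (auto simp: \<gamma>_def)
  then have "card \<gamma> < card \<alpha>" using fin psubset_card_mono by blast
  then have card: "card (\<alpha> - \<gamma>) = 1" "card (\<beta> - \<gamma>) = 1"
    using le eq fin by (auto simp: card_Diff_subset \<gamma>_def)
  obtain i j where ij: "\<alpha> - \<gamma> = {i}" "\<beta> - \<gamma> = {j}" using card by (auto simp: card_1_singleton_iff)
  show thesis
  proof (rule that(2)[of i \<gamma> j])
    show "\<alpha> = insert i \<gamma>" "\<beta> = insert j \<gamma>" using ij by (auto simp: \<gamma>_def)
    show "i \<notin> \<gamma>" "j \<notin> \<gamma>" "i \<noteq> j" using ij unfolding \<gamma>_def by auto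
  qed
qed (use that in auto)

section \<open>Nonvanishing of a single bordered minor\<close>

definition all_minors_nonzero :: "nat \<Rightarrow> (nat \<Rightarrow> nat \<Rightarrow> 'a :: comm_ring_1) \<Rightarrow> nat \<Rightarrow> bool" where
  "all_minors_nonzero n f k \<longleftrightarrow>
     (\<forall>\<alpha> \<beta>. quasi_principal n \<alpha> \<beta> \<and> card \<alpha> = k \<longrightarrow> minor f \<alpha> \<beta> \<noteq> 0)"

lemma trivial_kernelD:
  assumes "trivial_kernel f \<alpha> \<beta>" "\<And>a. a \<in> \<alpha> \<Longrightarrow> (\<Sum>b\<in>\<beta>. f a b * v b) = 0" "b \<in> \<beta>"
  shows "v b = 0"
  using assms unfolding trivial_kernel_def by blast

lemma all_minors_nonzero_trivial_kernel:
  fixes f :: "nat \<Rightarrow> nat \<Rightarrow> 'a :: field"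
  assumes "all_minors_nonzero n f k" "quasi_principal n \<alpha> \<beta>" "card \<alpha> = k"
  shows "trivial_kernel f \<alpha> \<beta>"
  using assms minor_nonzero_iff[of \<alpha> \<beta> f] finite_subset[of _ "{..<n}"]
  unfolding all_minors_nonzero_def quasi_principal_def by blast

text \<open>For \<open>z\<close> the unit vector at some \<open>l\<close> in
  \<open>L - \<gamma>\<close> the new column copies column \<open>l\<close>, and up to sign the
  minor is that of \<open>f\<close> with columns \<open>insert l \<gamma>\<close>. Such an
  \<open>l\<close> exists because \<gamma> has only \<open>k - 1\<close> elements.\<close>

lemma ex_border_minor_nonzero_column:
  fixes f :: "nat \<Rightarrow> nat \<Rightarrow> 'a :: field"
  assumes nz: "all_minors_nonzero n f k"
    and L: "L \<subseteq> {..<n}" "k \<le> card L"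
    and i: "insert i \<gamma> \<subseteq> {..<n}" "i \<notin> \<gamma>" "card (insert i \<gamma>) = k"
  shows "\<exists>z t. minor (border f n L z t) (insert i \<gamma>) (insert n \<gamma>) \<noteq> 0"
proof -
  have fin: "finite \<gamma>" "n \<notin> \<gamma>" using i finite_subset by auto
  obtain l where l: "l \<in> L" "l \<notin> \<gamma>"
    using L(2) i fin card_mono[of \<gamma> L] by (fastforce simp: subset_iff)
  define z :: "nat \<Rightarrow> 'a" where "z x = (if x = l then 1 else 0)" for x
  have ln: "insert l \<gamma> \<subseteq> {..<n}" using l L i by auto
  have tk: "trivial_kernel f (insert i \<gamma>) (insert l \<gamma>)"
    using all_minors_nonzero_trivial_kernel[OF nz] quasi_principal_insert i l ln by blast
  \<comment> \<open>The corner may be 0 since \<open>n\<close> occurs as a column but not as a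
    row.\<close>
  have "trivial_kernel (border f n L z 0) (insert i \<gamma>) (insert n \<gamma>)"
    unfolding trivial_kernel_def
  proof (intro allI impI)
    fix v assume v: "\<forall>a\<in>insert i \<gamma>. (\<Sum>b\<in>insert n \<gamma>. border f n L z 0 a b * v b) = 0"
    define u where "u b = (if b \<in> \<gamma> then v b else 0) + v n * z b" for b
    have z: "x \<in> insert l \<gamma> \<inter> L" if "z x \<noteq> 0" for x
      using that l by (auto simp: z_def split: if_splits)
    have S: "finite (insert l \<gamma>)" "\<gamma> \<subseteq> insert l \<gamma>" using fin by auto
    have "(\<Sum>b\<in>insert l \<gamma>. f a b * u b) = 0" if "a \<in> insert i \<gamma>" for a
    proof -
      have lt: "a < n" using that i by blast
      show ?thesis unfolding u_def
        by (rule trans[OF border_row_old[OF S ln L(1) z lt, symmetric] v[rule_format, OF that]])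
    qed
    from trivial_kernelD[OF tk this] have u: "u b = 0" if "b \<in> insert l \<gamma>" for b using that by blast
    have "v n = 0" using u[of l] l by (simp add: u_def z_def)
    moreover have "v b = 0" if "b \<in> \<gamma>" for b using u[of b] that \<open>v n = 0\<close> by (simp add: u_def)
    ultimately show "\<forall>b\<in>insert n \<gamma>. v b = 0" by blast
  qed
  moreover have "card (insert i \<gamma>) = card (insert n \<gamma>)" using i fin by simp
  ultimately show ?thesis using minor_nonzero_iff fin by blast
qed

text \<open>For \<open>z\<close> the unit vector at \<open>l\<close> and corner
  \<open>f l l\<close>, index \<open>n\<close> duplicates \<open>l\<close> in rows and columns. As
  \<open>l\<close> avoids both sets, exchanging \<open>n\<close> for \<open>l\<close> yields a minor
  of \<open>f\<close> up to sign.\<close>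

lemma ex_border_minor_nonzero_corner_disjoint:
  fixes f :: "nat \<Rightarrow> nat \<Rightarrow> 'a :: field"
  assumes sym: "\<And>i j. f i j = f j i"
    and L: "L \<subseteq> {..<n}" and l: "l \<in> L" "l \<notin> \<alpha>" "l \<notin> \<beta>"
    and sub: "\<alpha> \<subseteq> {..<n}" "\<beta> \<subseteq> {..<n}" "card \<alpha> = card \<beta>"
    and tk: "trivial_kernel f (insert l \<alpha>) (insert l \<beta>)"
  shows "\<exists>z t. minor (border f n L z t) (insert n \<alpha>) (insert n \<beta>) \<noteq> 0"
proof -
  have fin: "finite \<alpha>" "finite \<beta>" "n \<notin> \<alpha>" "n \<notin> \<beta>" "finite L"
    using sub L by (auto intro: finite_subset[OF _ finite_lessThan])
  define z :: "nat \<Rightarrow> 'a" where "z x = (if x = l then 1 else 0)" for x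
  define t where "t = (\<Sum>a\<in>L. z a * (\<Sum>l\<in>L. f a l * z l))"
  have "trivial_kernel (border f n L z t) (insert n \<alpha>) (insert n \<beta>)"
    unfolding trivial_kernel_def
  proof (intro allI impI)
    fix v assume v: "\<forall>a\<in>insert n \<alpha>. (\<Sum>b\<in>insert n \<beta>. border f n L z t a b * v b) = 0"
    define u where "u b = (if b \<in> \<beta> then v b else 0) + v n * z b" for b
    have z: "x \<in> insert l \<beta> \<inter> L" if "z x \<noteq> 0" for x using that l by (auto simp: z_def split: if_splits)
    have S: "insert l \<beta> \<subseteq> {..<n}" "finite (insert l \<beta>)" "\<beta> \<subseteq> insert l \<beta>"
      using l L sub fin by auto
    have old: "(\<Sum>b\<in>insert l \<beta>. f a b * u b) = 0" if "a \<in> \<alpha>" for a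
    proof -
      have lt: "a < n" using that sub by blast
      show ?thesis unfolding u_def
        by (rule trans[OF border_row_old[OF S(2) S(3) S(1) L z lt, symmetric]
          v[rule_format, OF insertI2[OF that]]])
    qed
    have new: "(\<Sum>a\<in>L. z a * (\<Sum>b\<in>insert l \<beta>. f a b * u b)) = 0"
      unfolding u_def
      by (rule trans[OF border_row_new[OF sym S(2) S(3) S(1) L z, symmetric]
        v[unfolded t_def, rule_format, OF insertI1]])
    \<comment> \<open>The new row thus contributes exactly the equation of row
      \<open>l\<close>.\<close>
    have "(\<Sum>a\<in>L. z a * g a) = g l" for g :: "nat \<Rightarrow> 'a"
      using l fin by (simp add: z_def if_distrib[of "\<lambda>x. x * _"] sum.delta cong: if_cong)
    from new[unfolded this] old have "(\<Sum>b\<in>insert l \<beta>. f a b * u b) = 0" if "a \<in> insert l \<alpha>" for a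
      using that by blast
    from trivial_kernelD[OF tk this] have u: "u b = 0" if "b \<in> insert l \<beta>" for b using that by blast
    have "v n = 0" using u[of l] l by (simp add: u_def z_def)
    moreover have "v b = 0" if "b \<in> \<beta>" for b using u[of b] that \<open>v n = 0\<close> by (simp add: u_def)
    ultimately show "\<forall>b\<in>insert n \<beta>. v b = 0" by blast
  qed
  moreover have "card (insert n \<alpha>) = card (insert n \<beta>)" using sub fin by simp
  ultimately show ?thesis using minor_nonzero_iff fin by blast
qed

text \<open>
  The witness is \<open>z = e\<^sub>i + e\<^sub>j\<close>: subtracting row \<open>i\<close> from the new row leaves row \<open>j\<close>, and subtracting
  column \<open>j\<close> from the new column leaves column \<open>i\<close>.
\<close>

lemma ex_border_minor_nonzero_corner_overlap:
  fixes f :: "nat \<Rightarrow> nat \<Rightarrow> 'a :: field"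
  assumes sym: "\<And>i j. f i j = f j i"
    and L: "L \<subseteq> {..<n}" and ij: "i \<in> L" "j \<in> L" "i \<notin> \<gamma>" "j \<notin> \<gamma>" "i \<noteq> j"
    and sub: "\<gamma> \<subseteq> {..<n}"
    and tk: "trivial_kernel f (insert i (insert j \<gamma>)) (insert i (insert j \<gamma>))"
  shows "\<exists>z t. minor (border f n L z t) (insert n (insert i \<gamma>)) (insert n (insert j \<gamma>)) \<noteq> 0"
proof -
  have fin: "finite \<gamma>" "n \<notin> \<gamma>" "finite L" "i < n" "j < n"
    using sub L ij by (auto intro: finite_subset[OF _ finite_lessThan])
  define z :: "nat \<Rightarrow> 'a" where "z x = (if x = i then 1 else 0) + (if x = j then 1 else 0)" for x
  define t where "t = (\<Sum>a\<in>L. z a * (\<Sum>l\<in>L. f a l * z l))"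
  let ?S = "insert i (insert j \<gamma>)"
  have ker: "trivial_kernel (border f n L z t) (insert n (insert i \<gamma>)) (insert n (insert j \<gamma>))"
    unfolding trivial_kernel_def
  proof (intro allI impI)
    fix v assume v: "\<forall>a\<in>insert n (insert i \<gamma>). (\<Sum>b\<in>insert n (insert j \<gamma>). border f n L z t a b * v b) = 0"
    define u where "u b = (if b \<in> insert j \<gamma> then v b else 0) + v n * z b" for b
    have z: "x \<in> ?S \<inter> L" if "z x \<noteq> 0" for x using that ij by (auto simp: z_def split: if_splits)
    have S: "?S \<subseteq> {..<n}" "finite ?S" "insert j \<gamma> \<subseteq> ?S" using sub fin by auto
    have old: "(\<Sum>b\<in>?S. f a b * u b) = 0" if "a \<in> insert i \<gamma>" for a
    proof -
      have lt: "a < n" using that S(1) by blast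
      show ?thesis unfolding u_def
        by (rule trans[OF border_row_old[OF S(2) S(3) S(1) L z lt, symmetric]
          v[rule_format, OF insertI2[OF that]]])
    qed
    have new: "(\<Sum>a\<in>L. z a * (\<Sum>b\<in>?S. f a b * u b)) = 0"
      unfolding u_def
      by (rule trans[OF border_row_new[OF sym S(2) S(3) S(1) L z, symmetric]
        v[unfolded t_def, rule_format, OF insertI1]])
    have "(\<Sum>a\<in>L. z a * g a) = g i + g j" for g :: "nat \<Rightarrow> 'a"
      using ij fin
      by (simp add: z_def algebra_simps sum.distrib if_distrib[of "\<lambda>x. _ * x"] sum.delta cong: if_cong)
    from new[unfolded this old[OF insertI1]] have "(\<Sum>b\<in>?S. f j b * u b) = 0" by (simp only: add_0)
    with old have "(\<Sum>b\<in>?S. f a b * u b) = 0" if "a \<in> ?S" for a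
      using that by blast
    from trivial_kernelD[OF tk this] have u: "u b = 0" if "b \<in> ?S" for b using that by blast
    \<comment> \<open>Since \<open>i\<close> is outside \<open>insert j \<gamma>\<close>, only the
      new column contributes there: \<open>u i = v n\<close>.\<close>
    from u[of i] have "v n = 0" using ij by (simp add: u_def z_def)
    moreover have "v b = 0" if "b \<in> insert j \<gamma>" for b
      using u[of b] that \<open>v n = 0\<close> by (auto simp: u_def)
    ultimately show "\<forall>b\<in>insert n (insert j \<gamma>). v b = 0" by blast
  qed
  have card: "card (insert n (insert i \<gamma>)) = card (insert n (insert j \<gamma>))" using ij fin by simp
  show ?thesis
    by (rule exI, rule exI, rule minor_nonzero_iff[THEN iffD2, OF _ _ card ker]) (use fin in simp_all)
qed

text \<open>The proof splits on where \<open>n\<close> lies. In neither set, the minor is one of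
  \<open>f\<close>; in one set, the column case applies, after transposition if \<open>n\<close> is
  a row; in both, a spare index of \<open>L\<close> or the witness on \<open>i\<close> and
  \<open>j\<close> is used.\<close>

lemma ex_border_minor_nonzero:
  fixes f :: "nat \<Rightarrow> nat \<Rightarrow> 'a :: field"
  assumes sym: "\<And>i j. f i j = f j i"
    and nz: "all_minors_nonzero n f k"
    and L: "L \<subseteq> {..<n}" "k \<le> card L"
    and qp: "quasi_principal (Suc n) \<alpha> \<beta>" "card \<alpha> = k"
  shows "\<exists>z t. minor (border f n L z t) \<alpha> \<beta> \<noteq> 0"
proof -
  have sub: "\<alpha> \<subseteq> {..<Suc n}" "\<beta> \<subseteq> {..<Suc n}" and card: "card \<alpha> = card \<beta>"
    using qp by (auto simp: quasi_principal_def)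
  have fin: "finite \<alpha>" "finite \<beta>" using sub finite_subset by auto
  have old: "\<delta> \<subseteq> {..<n}" if "\<delta> \<subseteq> {..<Suc n}" "n \<notin> \<delta>" for \<delta> using that by (auto simp: less_Suc_eq)
  have column: ?thesis if ab: "n \<notin> \<alpha>" "n \<in> \<beta>"
    using qp(1)
  proof (cases rule: quasi_principal_cases)
    case 1 with ab show ?thesis by simp
  next
    case (2 i j \<gamma>)
    then have "j = n" using ab by auto
    then show ?thesis
      using ex_border_minor_nonzero_column[OF nz L, of i \<gamma>] old[OF sub(1)] 2 qp(2) ab by simp
  qed
  have row: ?thesis if ab: "n \<in> \<alpha>" "n \<notin> \<beta>"
    using qp(1)
  proof (cases rule: quasi_principal_cases)
    case 1 with ab show ?thesis by simp
  next
    case (2 i j \<gamma>)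
    then have "i = n" using ab by auto
    then obtain z t where "minor (border f n L z t) \<beta> \<alpha> \<noteq> 0"
      using ex_border_minor_nonzero_column[OF nz L, of j \<gamma>] old[OF sub(2)] 2 qp(2) card ab by auto
    moreover have "minor (border f n L z t) \<beta> \<alpha> = minor (border f n L z t) \<alpha> \<beta>"
      by (intro minor_sym border_sym sym card[symmetric])
    ultimately show ?thesis by auto
  qed
  have corner: ?thesis if ab: "n \<in> \<alpha>" "n \<in> \<beta>"
  proof -
    define \<alpha>' \<beta>' where "\<alpha>' = \<alpha> - {n}" and "\<beta>' = \<beta> - {n}"
    have ins: "\<alpha> = insert n \<alpha>'" "\<beta> = insert n \<beta>'" using ab by (auto simp: \<alpha>'_def \<beta>'_def)
    have n': "n \<notin> \<alpha>'" "n \<notin> \<beta>'" by (auto simp: \<alpha>'_def \<beta>'_def)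
    have sub': "\<alpha>' \<subseteq> {..<n}" "\<beta>' \<subseteq> {..<n}" using sub by (auto simp: \<alpha>'_def \<beta>'_def less_Suc_eq)
    have fin': "finite \<alpha>'" "finite \<beta>'" using fin by (auto simp: \<alpha>'_def \<beta>'_def)
    have card': "card \<alpha>' = card \<beta>'" "Suc (card \<alpha>') = k" using card qp(2) fin' n' by (simp_all add: ins)
    have outside: "\<exists>l\<in>L. l \<notin> \<delta>" if "finite \<delta>" "card \<delta> < k" for \<delta>
      using that L(2) card_mono[of \<delta> L] by fastforce
    from qp(1) show ?thesis
    proof (cases rule: quasi_principal_cases)
      case 1
      then have eq: "\<alpha>' = \<beta>'" by (simp add: \<alpha>'_def \<beta>'_def)
      obtain l where l: "l \<in> L" "l \<notin> \<alpha>'" using outside[of \<alpha>'] fin' card' by auto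
      have "trivial_kernel f (insert l \<alpha>') (insert l \<alpha>')"
        using l L sub' fin' card'
        by (intro all_minors_nonzero_trivial_kernel[OF nz] quasi_principal_same) auto
      then show ?thesis
        using ex_border_minor_nonzero_corner_disjoint[OF sym L(1) l l(2) sub'(1) sub'(1)] eq
        by (simp add: ins)
    next
      case (2 i j \<gamma>')
      \<comment> \<open>Both sets contain \<open>n\<close> and \<open>i \<noteq> j\<close>, so
        \<open>n\<close> belongs to their common part.\<close>
      define \<gamma> where "\<gamma> = \<gamma>' - {n}"
      have ij: "\<alpha>' = insert i \<gamma>" "\<beta>' = insert j \<gamma>" "i \<notin> \<gamma>" "j \<notin> \<gamma>" "i \<noteq> j"
        using 2 ab by (auto simp: \<gamma>_def \<alpha>'_def \<beta>'_def)
      have fing: "finite \<gamma>" using fin' ij by simp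
      let ?S = "insert i (insert j \<gamma>)"
      have S: "?S \<subseteq> {..<n}" "card ?S = k" "finite ?S" using ij sub' fing card' by auto
      show ?thesis
      proof (cases "i \<in> L \<and> j \<in> L")
        case True
        then show ?thesis
          using ex_border_minor_nonzero_corner_overlap[OF sym L(1), of i j \<gamma>] ij S
            all_minors_nonzero_trivial_kernel[OF nz quasi_principal_same]
          by (auto simp: ins)
      next
        case False
        \<comment> \<open>The set \<open>?S\<close> has exactly \<open>k\<close> elements and is not
          contained in \<open>L\<close>, so it cannot exhaust \<open>L\<close> and a spare index
          remains.\<close>
        have "card (?S \<inter> L) < card ?S" using False S by (intro psubset_card_mono) auto
        then obtain l where l: "l \<in> L" "l \<notin> ?S" using outside[of "?S \<inter> L"] S by auto
        have "trivial_kernel f (insert i (insert l \<gamma>)) (insert j (insert l \<gamma>))"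
          using l L ij S fing card'
          by (intro all_minors_nonzero_trivial_kernel[OF nz] quasi_principal_insert) auto
        then show ?thesis
          using ex_border_minor_nonzero_corner_disjoint[OF sym L(1) l(1), of \<alpha>' \<beta>'] l ij sub' card'
          by (simp add: ins insert_commute)
      qed
    qed
  qed
  have ?thesis if "n \<notin> \<alpha>" "n \<notin> \<beta>"
  proof -
    have ab: "\<alpha> \<subseteq> {..<n}" "\<beta> \<subseteq> {..<n}" using old sub that by auto
    then have "minor (border f n L z t) \<alpha> \<beta> = minor f \<alpha> \<beta>" for z t
      by (intro minor_cong) (auto simp: border_def)
    moreover have "quasi_principal n \<alpha> \<beta>" using qp(1) ab unfolding quasi_principal_def by blast
    ultimately show ?thesis using nz qp(2) by (simp add: all_minors_nonzero_def)
  qed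
  with column row corner show ?thesis by blast
qed

section \<open>Generic choice of the border\<close>

lemma border_fun_upd:
  "L \<subseteq> {..<n} \<Longrightarrow> border f n L (z(n := t)) = border f n L z"
  by (intro ext) (auto simp: border_def intro!: sum.cong)

text \<open>The bordered matrix is block diagonal with blocks \<open>f\<close> and 1.\<close>

lemma border_det_nonzero:
  fixes f :: "nat \<Rightarrow> nat \<Rightarrow> 'a :: field"
  assumes "minor f {..<n} {..<n} \<noteq> 0"
  shows "minor (border f n L (\<lambda>_. 0) 1) {..<Suc n} {..<Suc n} \<noteq> 0"
proof -
  have tk: "trivial_kernel f {..<n} {..<n}" using assms by (simp add: minor_nonzero_iff)
  have "trivial_kernel (border f n L (\<lambda>_. 0) 1) {..<Suc n} {..<Suc n}"
    unfolding trivial_kernel_def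
  proof (intro allI impI)
    fix v assume v: "\<forall>a\<in>{..<Suc n}. (\<Sum>b<Suc n. border f n L (\<lambda>_. 0) 1 a b * v b) = 0"
    have "(\<Sum>b<n. f a b * v b) = 0" if "a \<in> {..<n}" for a
      using v[rule_format, of a] that by (simp add: border_def)
    from trivial_kernelD[OF tk this] have "v b = 0" if "b < n" for b using that by blast
    moreover have "v n = 0" using v[rule_format, of n] by (simp add: border_def)
    ultimately show "\<forall>b\<in>{..<Suc n}. v b = 0" by (auto simp: less_Suc_eq)
  qed
  then show ?thesis by (simp add: minor_nonzero_iff)
qed

text \<open>Only finitely many minors are involved, each polynomial along lines in the border data
  and nonzero for some border. Hence one border serves all of them, for all orders \<open>k\<close>
  at once.\<close>

lemma generic_border:
  fixes f :: "nat \<Rightarrow> nat \<Rightarrow> 'a :: field_char_0"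
  assumes sym: "\<And>i j. f i j = f j i"
    and det: "minor f {..<n} {..<n} \<noteq> 0"
    and L: "L \<subseteq> {..<n}"
  obtains z t where "minor (border f n L z t) {..<Suc n} {..<Suc n} \<noteq> 0"
    and "\<And>k. k \<le> card L \<Longrightarrow> all_minors_nonzero n f k \<Longrightarrow> all_minors_nonzero (Suc n) (border f n L z t) k"
proof -
  define I where "I = insert ({..<Suc n}, {..<Suc n}) {(\<alpha>, \<beta>).
    quasi_principal (Suc n) \<alpha> \<beta> \<and> card \<alpha> \<le> card L \<and> all_minors_nonzero n f (card \<alpha>)}"
  define F where "F = (\<lambda>(\<alpha>, \<beta>) p. minor (border f n L p (p n)) \<alpha> \<beta>)"
  have "I \<subseteq> Pow {..<Suc n} \<times> Pow {..<Suc n}" by (auto simp: I_def quasi_principal_def)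
  then have "finite I" by (rule finite_subset) auto
  moreover have "line_polynomial (F i)" if "i \<in> I" for i
    using that unfolding F_def I_def
    by (auto intro!: line_polynomial_minor line_polynomial_border simp: quasi_principal_def)
  moreover have "\<exists>p. F i p \<noteq> 0" if "i \<in> I" for i
  proof -
    obtain \<alpha> \<beta> where i: "i = (\<alpha>, \<beta>)" by (cases i)
    have "\<exists>z t. minor (border f n L z t) \<alpha> \<beta> \<noteq> 0"
    proof (cases "\<alpha> = {..<Suc n} \<and> \<beta> = {..<Suc n}")
      case True
      \<comment> \<open>The determinant has order \<open>Suc n\<close>, beyond
        \<open>card L\<close>, and needs its own witness.\<close>
      then show ?thesis using border_det_nonzero[OF det] by blast
    next
      case False
      then show ?thesis using that i ex_border_minor_nonzero[OF sym _ L] by (auto simp: I_def)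
    qed
    then obtain z t where "minor (border f n L z t) \<alpha> \<beta> \<noteq> 0" by blast
    \<comment> \<open>Coordinate \<open>n\<close> lies outside \<open>L\<close>, so it is free to
      store the corner.\<close>
    then have "F i (z(n := t)) \<noteq> 0" by (simp add: F_def i border_fun_upd[OF L])
    then show ?thesis by blast
  qed
  ultimately obtain p where p: "\<forall>i\<in>I. F i p \<noteq> 0" using ex_common_nonzero by blast
  show thesis
  proof (rule that)
    show "minor (border f n L p (p n)) {..<Suc n} {..<Suc n} \<noteq> 0" using p by (simp add: I_def F_def)
    show "all_minors_nonzero (Suc n) (border f n L p (p n)) k"
      if "k \<le> card L" "all_minors_nonzero n f k" for k
      using p that by (auto simp: all_minors_nonzero_def I_def F_def)
  qed
qed

lemma quasi_principal_full:
  assumes "quasi_principal n \<alpha> \<beta>" "card \<alpha> = n"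
  shows "\<alpha> = {..<n}" "\<beta> = {..<n}"
  using assms card_subset_eq[of "{..<n}"] by (auto simp: quasi_principal_def)

lemma all_minors_nonzero_full: "all_minors_nonzero n f n \<longleftrightarrow> minor f {..<n} {..<n} \<noteq> 0"
  using quasi_principal_full[of n] quasi_principal_same[of "{..<n}" n]
  unfolding all_minors_nonzero_def by (metis card_lessThan subset_refl)

section \<open>Attaining a sequence\<close>

abbreviation letter :: "nat \<Rightarrow> (nat \<Rightarrow> nat \<Rightarrow> 'a :: comm_ring_1) \<Rightarrow> nat \<Rightarrow> qpr_letter" where
  "letter n f \<equiv> qpr_entry (mat n n (\<lambda>(i, j). f i j))"

lemma qp_minors_mat:
  "qp_minors (mat n n (\<lambda>(i, j). f i j)) k =
    {minor f \<alpha> \<beta> | \<alpha> \<beta>. quasi_principal n \<alpha> \<beta> \<and> card \<alpha> = k}"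
proof -
  have "det (submatrix (mat n n (\<lambda>(i, j). f i j)) \<alpha> \<beta>) = minor f \<alpha> \<beta>"
    if "quasi_principal n \<alpha> \<beta>" for \<alpha> \<beta>
    using that by (simp add: minor_def submatrix_mat_eq quasi_principal_def)
  then show ?thesis unfolding qp_minors_def dim_row_mat by (auto; metis)
qed

lemma letter_eq_A_iff: "letter n f k = qA \<longleftrightarrow> all_minors_nonzero n f k"
  unfolding qpr_entry_def qp_minors_mat all_minors_nonzero_def by auto

lemma letter_eq_S_iff: "letter n f k = qS \<longleftrightarrow>
    (\<exists>\<alpha> \<beta>. quasi_principal n \<alpha> \<beta> \<and> card \<alpha> = k \<and> minor f \<alpha> \<beta> \<noteq> 0) \<and>
    (\<exists>\<alpha> \<beta>. quasi_principal n \<alpha> \<beta> \<and> card \<alpha> = k \<and> minor f \<alpha> \<beta> = 0)"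
  unfolding qpr_entry_def qp_minors_mat by auto

section \<open>Appending one letter\<close>

lemma quasi_principal_mono: "quasi_principal n \<alpha> \<beta> \<Longrightarrow> n \<le> m \<Longrightarrow> quasi_principal m \<alpha> \<beta>"
  by (auto simp: quasi_principal_def subset_iff)

lemma minor_border_old:
  "quasi_principal n \<alpha> \<beta> \<Longrightarrow> minor (border f n L z t) \<alpha> \<beta> = minor f \<alpha> \<beta>"
  by (intro minor_cong) (auto simp: border_def quasi_principal_def)

text \<open>The new column is a combination of the columns in \<open>L\<close>, all of which are
  present once column \<open>m\<close> is dropped.\<close>

lemma minor_border_dependent_column:
  fixes f :: "nat \<Rightarrow> nat \<Rightarrow> 'a :: field"
  assumes L: "L \<subseteq> {..<n}" and m: "m < n" "m \<notin> L"
  shows "minor (border f n L z t) {..<n} (insert n ({..<n} - {m})) = 0"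
proof (rule ccontr)
  let ?\<beta> = "{..<n} - {m}"
  assume "minor (border f n L z t) {..<n} (insert n ?\<beta>) \<noteq> 0"
  moreover have "card {..<n} = card (insert n ?\<beta>)" using m by simp
  ultimately have tk: "trivial_kernel (border f n L z t) {..<n} (insert n ?\<beta>)"
    by (subst (asm) minor_nonzero_iff) auto
  \<comment> \<open>These are the coefficients of that linear relation, with -1 on the new
    column.\<close>
  define v where "v b = (if b = n then -1 else if b \<in> L then z b else 0)" for b
  have "(\<Sum>b\<in>insert n ?\<beta>. border f n L z t a b * v b) = 0" if a: "a \<in> {..<n}" for a
  proof -
    have "(\<Sum>b\<in>?\<beta>. border f n L z t a b * v b) = (\<Sum>l\<in>L. f a l * z l)"
      by (rule sum.mono_neutral_cong_right) (use a L m in \<open>auto simp: border_def v_def\<close>)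
    moreover have "border f n L z t a n * v n = - (\<Sum>l\<in>L. f a l * z l)"
      using a by (simp add: border_def v_def)
    ultimately show ?thesis by (subst sum.insert) simp_all
  qed
  from trivial_kernelD[OF tk this] have "v n = 0" by blast
  then show False by (simp add: v_def)
qed

text \<open>Bordering turns the letter at order \<open>n\<close> into \<open>c\<close>, adds
  \<open>qA\<close> at order \<open>Suc n\<close>, and keeps every earlier \<open>qA\<close> or
  \<open>qS\<close>.\<close>

lemma append_letter:
  fixes f :: "nat \<Rightarrow> nat \<Rightarrow> 'a :: field_char_0"
  assumes sym: "\<And>i j. f i j = f j i" and n: "n > 0" and last: "letter n f n = qA" and c: "c \<noteq> qN"
  shows "\<exists>g :: nat \<Rightarrow> nat \<Rightarrow> 'a. (\<forall>i j. g i j = g j i) \<and> letter (Suc n) g (Suc n) = qA \<and>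
    letter (Suc n) g n = c \<and> (\<forall>k<n. letter n f k \<noteq> qN \<longrightarrow> letter (Suc n) g k = letter n f k)"
proof -
  \<comment> \<open>Without index 0, \<open>card L = n - 1\<close> still covers all orders below
    \<open>n\<close> but no longer forces \<open>qA\<close> at order \<open>n\<close>.\<close>
  define L where "L = (if c = qA then {..<n} else {..<n} - {0})"
  have L: "L \<subseteq> {..<n}" by (auto simp: L_def)
  have det: "minor f {..<n} {..<n} \<noteq> 0"
    using last unfolding letter_eq_A_iff all_minors_nonzero_full .
  obtain z t where detg: "minor (border f n L z t) {..<Suc n} {..<Suc n} \<noteq> 0"
    and A: "\<And>k. k \<le> card L \<Longrightarrow> all_minors_nonzero n f k \<Longrightarrow> all_minors_nonzero (Suc n) (border f n L z t) k"
    using generic_border[OF sym det L] by blast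
  let ?g = "border f n L z t"
  have "letter (Suc n) ?g k = letter n f k" if k: "k < n" "letter n f k \<noteq> qN" for k
  proof (cases "letter n f k")
    case qA
    moreover have "k \<le> card L" using k by (auto simp: L_def)
    ultimately have "letter (Suc n) ?g k = qA" using A unfolding letter_eq_A_iff by blast
    with qA show ?thesis by simp
  next
    case qS
    \<comment> \<open>An \<open>S\<close> persists because the minors of \<open>f\<close> remain
      minors of the bordered matrix.\<close>
    then obtain \<alpha> \<beta> \<alpha>' \<beta>' where "quasi_principal n \<alpha> \<beta>" "card \<alpha> = k" "minor f \<alpha> \<beta> \<noteq> 0"
      "quasi_principal n \<alpha>' \<beta>'" "card \<alpha>' = k" "minor f \<alpha>' \<beta>' = 0"
      unfolding letter_eq_S_iff by blast
    moreover from this have "minor ?g \<alpha> \<beta> \<noteq> 0" "minor ?g \<alpha>' \<beta>' = 0"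
      by (simp_all add: minor_border_old)
    moreover have "quasi_principal (Suc n) \<delta> \<epsilon>" if "quasi_principal n \<delta> \<epsilon>" for \<delta> \<epsilon>
      using quasi_principal_mono[OF that] by simp
    ultimately have "letter (Suc n) ?g k = qS" unfolding letter_eq_S_iff by blast
    with qS show ?thesis by simp
  qed (use k in simp)
  moreover have "letter (Suc n) ?g n = c"
  proof (cases c)
    case qA
    then have "n \<le> card L" by (simp add: L_def)
    then show ?thesis using A last qA by (simp add: letter_eq_A_iff)
  next
    case qS
    have qp: "quasi_principal n {..<n} {..<n}" by (simp add: quasi_principal_same)
    \<comment> \<open>Replacing column 0 by the new column gives the vanishing minor of order
      \<open>n\<close>; the determinant of \<open>f\<close> is the nonzero one.\<close>
    have "{..<n} = insert 0 ({..<n} - {0})" using n by auto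
    moreover have "quasi_principal (Suc n) (insert 0 ({..<n} - {0})) (insert n ({..<n} - {0}))"
      by (rule quasi_principal_insert) (use n in auto)
    ultimately have "quasi_principal (Suc n) {..<n} (insert n ({..<n} - {0}))" by simp
    moreover have "minor ?g {..<n} (insert n ({..<n} - {0})) = 0"
      using qS n by (intro minor_border_dependent_column L) (auto simp: L_def)
    moreover have "minor ?g {..<n} {..<n} \<noteq> 0" using det by (simp add: minor_border_old[OF qp])
    moreover have "quasi_principal (Suc n) {..<n} {..<n}" using quasi_principal_mono[OF qp] by simp
    ultimately have "letter (Suc n) ?g n = qS" unfolding letter_eq_S_iff using card_lessThan by blast
    with qS show ?thesis by simp
  qed (use c in simp)
  moreover have "letter (Suc n) ?g (Suc n) = qA"
    unfolding letter_eq_A_iff all_minors_nonzero_full by (rule detg)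
  ultimately show ?thesis using border_sym[of f, OF sym] by blast
qed

section \<open>Building the whole sequence\<close>

lemma qpr_mat: "qpr (mat n n (\<lambda>(i, j). f i j)) = map (letter n f) [1..<Suc n]"
  by (simp add: qpr_def)

text \<open>Induction on the part before the final \<open>qA\<close>. That letter provides the
  nonsingular matrix to border; the step overwrites it with the new letter and places a fresh
  \<open>qA\<close> after it.\<close>

lemma qpr_attainable:
  assumes "qN \<notin> set s"
  shows "\<exists>f :: nat \<Rightarrow> nat \<Rightarrow> 'a :: field_char_0. (\<forall>i j. f i j = f j i) \<and>
    map (letter (Suc (length s)) f) [1..<Suc (Suc (length s))] = s @ [qA]"
  using assms
proof (induction s rule: rev_induct)
  case Nil
  define f :: "nat \<Rightarrow> nat \<Rightarrow> 'a" where "f i j = 1" for i j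
  have "minor f {..<Suc 0} {..<Suc 0} \<noteq> 0"
    by (subst minor_nonzero_iff) (auto simp: trivial_kernel_def f_def)
  then have "letter (Suc 0) f (Suc 0) = qA"
    unfolding letter_eq_A_iff all_minors_nonzero_full .
  moreover have "\<forall>i j. f i j = f j i" by (simp add: f_def)
  ultimately show ?case by (intro exI[of _ f]) simp
next
  case (snoc c s)
  define n where "n = Suc (length s)"
  have "qN \<notin> set s" using snoc.prems by simp
  from snoc.IH[OF this] obtain f :: "nat \<Rightarrow> nat \<Rightarrow> 'a" where sym: "\<And>i j. f i j = f j i"
    and f: "map (letter n f) [1..<Suc n] = s @ [qA]"
    unfolding n_def by blast
  have split: "[1..<Suc n] = [1..<n] @ [n]" by (simp add: n_def)
  have init: "map (letter n f) [1..<n] = s" and last: "letter n f n = qA"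
    using f unfolding split by simp_all
  obtain g :: "nat \<Rightarrow> nat \<Rightarrow> 'a" where g: "\<forall>i j. g i j = g j i" "letter (Suc n) g (Suc n) = qA"
    "letter (Suc n) g n = c" "\<forall>k<n. letter n f k \<noteq> qN \<longrightarrow> letter (Suc n) g k = letter n f k"
    using append_letter[OF sym _ last, of c] snoc.prems by (auto simp: n_def)
  have "letter n f k \<noteq> qN" if "k \<in> set [1..<n]" for k
  proof -
    have "letter n f k \<in> set (map (letter n f) [1..<n])" using that by simp
    then show ?thesis using snoc.prems unfolding init by auto
  qed
  then have init_g: "map (letter (Suc n) g) [1..<n] = s"
    using g(4) unfolding init[symmetric] by (intro map_cong) auto
  have "[1..<Suc (Suc n)] = [1..<n] @ [n] @ [Suc n]" by (simp add: n_def)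
  then have new: "map (letter (Suc n) g) [1..<Suc (Suc n)] = (s @ [c]) @ [qA]"
    by (simp only: map_append init_g list.map g(2,3) append_assoc)
  have len: "length (s @ [c]) = n" by (simp add: n_def)
  show ?case unfolding len by (rule exI[of _ g], rule conjI[OF g(1) new])
qed

theorem theorem3p5:
  fixes s :: "qpr_letter list"
  assumes "s \<noteq> []"
    and "qN \<notin> set s"
    and "last s = qA"
  shows "\<exists>(n :: nat) (B :: 'a :: field_char_0 mat).
    B \<in> carrier_mat n n \<and> transpose_mat B = B \<and> qpr B = s"
proof -
  have s: "s = butlast s @ [qA]" using assms append_butlast_last_id[of s] by simp
  have "qN \<notin> set (butlast s)" using assms(2) by (meson in_set_butlastD)
  then obtain f :: "nat \<Rightarrow> nat \<Rightarrow> 'a" where sym: "\<forall>i j. f i j = f j i" and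
    f: "map (letter (Suc (length (butlast s))) f) [1..<Suc (Suc (length (butlast s)))] = butlast s @ [qA]"
    using qpr_attainable by blast
  define n where "n = Suc (length (butlast s))"
  let ?B = "mat n n (\<lambda>(i, j). f i j)"
  have "qpr ?B = s" unfolding qpr_mat n_def f by (rule s[symmetric])
  moreover have "transpose_mat ?B = ?B" using sym by (intro eq_matI) auto
  moreover have "?B \<in> carrier_mat n n" by simp
  ultimately show ?thesis by blast
qed

end
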